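(* Let $\xi\in[0,1]$. For $l=0$ (and $m\ge 0$), $$(\mathcal{H}_0^m)'(\xi)=\frac{(-1)^{m+1}}{2^{2m}}\,\frac{(2m+1)!}{(m!)^2}\,\mathcal{J}_{2m}^{m-1}(2\xi-1),$$ and for $m>1$ and $l=1,2,\ldots,m$, $$(\mathcal{H}_l^m)'(\xi)=\frac{(-1)^{m+1}}{2^{2m}}\,\frac{(2m-l)!\,(2m+1)}{l!\,m!\,(m-l)!}\,\mathcal{J}_{2m}^{m-1}(2\xi-1)+\mathcal{H}_{l-1}^{m-1}(\xi).$$
   Context: For integers $m\ge 0$, $0\le l\le m$ define the Hermite splines $$\mathcal{H}_l^m(\xi)=\frac{(1-\xi)^{m+1}\xi^l}{l!}\sum_{n=0}^{m-l}\frac{(m+n)!}{m!\,n!}\,\xi^n,\qquad \xi\in[0,1].$$ For integers $m\ge -1$, $p\ge 2m+2$ define the monic polynomials $$\mathcal{J}_p^m(\mu)=J_{m,p}(\mu^2-1)^{m+1}P_{p-m-1}^{(m+1)}(\mu),\qquad J_{m,p}=\frac{2^{p-m-2}(p-m-2)!\,(p-2m-2)!}{(2p-2m-3)!},$$ where $P_n$ is the Legendre polynomial of degree $n$, $P_n^{(j)}$ its $j$-th derivative, and $J_{-1,0}=1$ by convention. *)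

theory Defs
  imports Complex_Main "HOL-Computational_Algebra.Polynomial"
begin

text \<open>
  The Hermite spline \<open>H_l^m\<close>, for \<open>l \<le> m\<close>.  Its domain is \<open>[0,1]\<close>, so derivatives of it
  are to be taken within that interval (one-sided at the end points).
\<close>

definition hermite_spline :: "nat \<Rightarrow> nat \<Rightarrow> real \<Rightarrow> real" where
  "hermite_spline l m \<xi> =
     (1 - \<xi>) ^ (m + 1) * \<xi> ^ l / fact l * (\<Sum>n = 0..m - l. fact (m + n) / (fact m * fact n) * \<xi> ^ n)"

text \<open>Rodrigues' formula, with the usual normalisation \<open>P_n(1) = 1\<close>.\<close>

definition legendre_poly :: "nat \<Rightarrow> real poly" where
  "legendre_poly n = smult (1 / (2 ^ n * fact n)) ((pderiv ^^ n) ([:-1, 0, 1:] ^ n))"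

text \<open>
  For \<open>m \<ge> -1\<close> and \<open>p \<ge> 2m + 2\<close>, the arguments of all applications of \<^const>\<open>nat\<close> below are
  nonnegative: the only exception, \<open>(m, p) = (-1, 0)\<close>, is covered by the convention.
\<close>

definition J_coeff :: "int \<Rightarrow> int \<Rightarrow> real" where
  "J_coeff m p =
     (if m = -1 \<and> p = 0 then 1
      else 2 ^ nat (p - m - 2) * fact (nat (p - m - 2)) * fact (nat (p - 2 * m - 2))
             / fact (nat (2 * p - 2 * m - 3)))"

definition J_poly :: "int \<Rightarrow> int \<Rightarrow> real poly" where
  "J_poly m p =
     smult (J_coeff m p)
       ([:-1, 0, 1:] ^ nat (m + 1) * (pderiv ^^ nat (m + 1)) (legendre_poly (nat (p - m - 1))))"

end

theory Submission
  imports Defs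
begin

text \<open>
  Since \<open>P_m^(m) = (2m)! / (2^m m!)\<close> is constant, the polynomial \<open>J_{2m}^{m-1}\<close> collapses to
  \<open>(\<mu>^2 - 1)^m\<close>, which at \<open>\<mu> = 2\<xi> - 1\<close> is \<open>(-4)^m \<xi>^m (1 - \<xi>)^m\<close>.  The sum in the spline is a
  truncation \<open>S_{m,k}\<close> of the binomial series of \<open>(1 - \<xi>)^(-m-1)\<close>, so the derivative of
  \<open>(1 - \<xi>)^(m+1) S_{m,k}(\<xi>)\<close> is the single monomial term \<open>-(m+k+1)!/(m! k!) \<xi>^k (1 - \<xi>)^m\<close>.
  In the product rule for \<open>\<xi>^l / l!\<close> times this function, Pascal's rule
  \<open>(1 - \<xi>) S_{m,k} = S_{m-1,k} - c \<xi>^(k+1)\<close>, where \<open>c\<close> is \<open>m + k\<close> choose \<open>k\<close>, turns the other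
  term into \<open>H_{l-1}^{m-1}\<close> and one more multiple of \<open>\<xi>^m (1 - \<xi>)^m\<close>.
\<close>

lemma higher_pderiv_degree:
  fixes p :: "'a :: {idom, semiring_char_0} poly"
  assumes "degree p \<le> n"
  shows "(pderiv ^^ n) p = [:fact n * coeff p n:]"
proof (rule poly_eqI)
  fix i
  show "coeff ((pderiv ^^ n) p) i = coeff [:fact n * coeff p n:] i"
    using assms
    by (cases i) (auto simp: coeff_higher_pderiv pochhammer_fact coeff_eq_0)
qed

text \<open>Rodrigues' formula turns this into the derivative of order \<open>2 * m\<close> of a
  monic polynomial of degree \<open>2 * m\<close>.\<close>

lemma higher_pderiv_legendre_poly:
  "(pderiv ^^ m) (legendre_poly m) = [:fact (2 * m) / (2 ^ m * fact m):]"
proof -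
  let ?q = "[:-1, 0, 1:] :: real poly"
  have "degree (?q ^ m) = 2 * m"
    by (simp add: degree_power_eq)
  moreover have "lead_coeff (?q ^ m) = 1"
    by (simp add: lead_coeff_power)
  ultimately have "(pderiv ^^ (m + m)) (?q ^ m) = [:fact (2 * m):]"
    using higher_pderiv_degree[of "?q ^ m" "m + m"] by (simp add: mult_2)
  then show ?thesis
    by (simp add: legendre_poly_def higher_pderiv_smult funpow_add)
qed

lemma poly_J_poly_twice:
  "poly (J_poly (int m - 1) (2 * int m)) \<mu> = (\<mu>\<^sup>2 - 1) ^ m"
proof (cases m)
  case 0
  \<comment> \<open>This is the pair (-1, 0), where \<open>J_coeff\<close> is 1 by
    convention.\<close>
  then show ?thesis
    by (simp add: J_poly_def J_coeff_def legendre_poly_def)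
next
  case (Suc k)
  have nats: "nat (2 * int m - (int m - 1) - 2) = k"
    "nat (2 * int m - 2 * (int m - 1) - 2) = 0"
    "nat (2 * (2 * int m) - 2 * (int m - 1) - 3) = 2 * k + 1"
    "nat (int m - 1 + 1) = m" "nat (2 * int m - (int m - 1) - 1) = m"
    using Suc by auto
  \<comment> \<open>The normalisation that makes the polynomial monic cancels the constant
    derivative of the Legendre factor.\<close>
  have coeff: "J_coeff (int m - 1) (2 * int m) * (fact (2 * m) / (2 ^ m * fact m)) = 1"
  proof -
    have "(fact (2 * m) :: real) = 2 * real m * fact (2 * k + 1)"
      using Suc fact_Suc[of "2 * k + 1"] by simp
    moreover have "(fact m :: real) = real m * fact k" "(2 :: real) ^ m = 2 * 2 ^ k"
      using Suc by simp_all
    ultimately show ?thesis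
      unfolding J_coeff_def nats using Suc by (simp del: fact_Suc)
  qed
  have "poly (J_poly (int m - 1) (2 * int m)) \<mu>
      = J_coeff (int m - 1) (2 * int m) * (fact (2 * m) / (2 ^ m * fact m)) * (\<mu>\<^sup>2 - 1) ^ m"
    unfolding J_poly_def nats higher_pderiv_legendre_poly
    by (simp add: power2_eq_square)
  then show ?thesis
    unfolding coeff by simp
qed

definition negbinom_sum :: "nat \<Rightarrow> nat \<Rightarrow> real \<Rightarrow> real" where
  "negbinom_sum m k x = (\<Sum>n = 0..k. fact (m + n) / (fact m * fact n) * x ^ n)"

text \<open>The factor \<open>1 - x\<close> turns the series of (1 - x)^(-m-2) into that of (1 -
  x)^(-m-1); truncation leaves only the boundary term.\<close>

lemma negbinom_sum_Suc_left:
  "(1 - x) * negbinom_sum (Suc m) k x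
     = negbinom_sum m k x - fact (Suc m + k) / (fact (Suc m) * fact k) * x ^ Suc k"
proof (induction k)
  case 0
  show ?case
    by (simp add: negbinom_sum_def)
next
  case (Suc k)
  let ?c = "fact (Suc m + Suc k) / (fact (Suc m) * fact (Suc k)) :: real"
  let ?d = "fact (m + Suc k) / (fact m * fact (Suc k)) :: real"
  have split: "negbinom_sum (Suc m) (Suc k) x = negbinom_sum (Suc m) k x + ?c * x ^ Suc k"
    "negbinom_sum m (Suc k) x = negbinom_sum m k x + ?d * x ^ Suc k"
    by (simp_all add: negbinom_sum_def)
  have pascal: "fact (Suc m + k) / (fact (Suc m) * fact k) = ?c - ?d"
    by (simp add: divide_simps) (simp add: algebra_simps)
  show ?case
    unfolding split distrib_left Suc.IH pascal
    by (simp add: algebra_simps add_divide_distrib diff_divide_distrib del: fact_Suc)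
qed

text \<open>With the full series the product would be constantly 1, so only the cut at
  \<open>k\<close> contributes. The induction telescopes: each new summand cancels the previous
  boundary term.\<close>

lemma has_real_derivative_power_mult_negbinom_sum:
  "((\<lambda>x. (1 - x) ^ Suc m * negbinom_sum m k x) has_real_derivative
     - (fact (m + k + 1) / (fact m * fact k)) * x ^ k * (1 - x) ^ m) (at x)"
proof (induction k)
  case 0
  show ?case
    unfolding negbinom_sum_def
    by (auto intro!: derivative_eq_intros simp: field_simps simp del: power_Suc)
next
  case (Suc k)
  let ?c = "fact (m + Suc k) / (fact m * fact (Suc k)) :: real"
  have split: "(\<lambda>x. (1 - x) ^ Suc m * negbinom_sum m (Suc k) x)
      = (\<lambda>x. (1 - x) ^ Suc m * negbinom_sum m k x + ?c * (x ^ Suc k * (1 - x) ^ Suc m))"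
    by (simp add: negbinom_sum_def algebra_simps)
  have term_deriv: "((\<lambda>x. ?c * (x ^ Suc k * (1 - x) ^ Suc m)) has_real_derivative
      ?c * ((1 + real k) * x ^ k * (1 - x) ^ Suc m - (1 + real m) * (1 - x) ^ m * x ^ Suc k)) (at x)"
    by (rule derivative_eq_intros refl | simp del: power_Suc fact_Suc)+
  \<comment> \<open>In terms of \<open>?c\<close>, the induction hypothesis cancels against part of
    the new term once one factor \<open>1 - x\<close> is expanded; (k + 1) + (m + 1)
    remains.\<close>
  have coeffs: "fact (m + k + 1) / (fact m * fact k) = ?c * (1 + real k)"
    "fact (m + Suc k + 1) / (fact m * fact (Suc k)) = ?c * (real m + real k + 2)"
    by (simp_all add: divide_simps)
  show ?case
    unfolding split coeffs(2)
    by (rule DERIV_cong[OF DERIV_add[OF Suc.IH[unfolded coeffs(1)] term_deriv]])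
      (simp add: algebra_simps add_divide_distrib del: fact_Suc)
qed

lemma hermite_spline_alt:
  "hermite_spline l m = (\<lambda>x. x ^ l / fact l * ((1 - x) ^ Suc m * negbinom_sum m (m - l) x))"
  by (simp add: fun_eq_iff hermite_spline_def negbinom_sum_def)

lemma hermite_spline_0_derivative:
  "(hermite_spline 0 m has_real_derivative
     - (fact (2 * m + 1) / (fact m)\<^sup>2) * (x * (1 - x)) ^ m) (at x)"
proof -
  have "- (fact (2 * m + 1) / (fact m)\<^sup>2) * (x * (1 - x)) ^ m
      = - (fact (m + m + 1) / (fact m * fact m)) * x ^ m * (1 - x) ^ m"
    by (simp add: power_mult_distrib power2_eq_square flip: mult_2)
  then show ?thesis
    using has_real_derivative_power_mult_negbinom_sum[of m m x]
    by (simp add: hermite_spline_alt)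
qed

lemma hermite_spline_Suc_derivative:
  assumes "l \<le> m"
  shows "(hermite_spline (Suc l) (Suc m) has_real_derivative
     - (fact (2 * Suc m - Suc l) * (2 * real (Suc m) + 1)
         / (fact (Suc l) * fact (Suc m) * fact (m - l))) * (x * (1 - x)) ^ Suc m
     + hermite_spline l m x) (at x)"
proof -
  obtain k where m: "m = l + k"
    using assms le_Suc_ex by blast
  have mono: "((\<lambda>x::real. x ^ Suc l / fact (Suc l)) has_real_derivative x ^ l / fact l) (at x)"
    by (rule derivative_eq_intros refl | simp del: power_Suc fact_Suc)+
      (simp add: divide_simps)
  let ?A = "- (fact (Suc m + k + 1) / (fact (Suc m) * fact k)) * x ^ k * (1 - x) ^ Suc m"
  let ?B = "fact (Suc m + k) / (fact (Suc m) * fact k) * x ^ Suc k :: real"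
  have "(hermite_spline (Suc l) (Suc m) has_real_derivative
      x ^ l / fact l * ((1 - x) ^ Suc (Suc m) * negbinom_sum (Suc m) k x)
      + ?A * (x ^ Suc l / fact (Suc l))) (at x)"
    unfolding hermite_spline_alt
    using DERIV_mult[OF mono has_real_derivative_power_mult_negbinom_sum[of "Suc m" k x]]
    by (simp add: m)
  \<comment> \<open>Spending one factor \<open>1 - x\<close> on the sum lowers its order to
    \<open>m\<close>, while the cut \<open>k\<close> = \<open>m - l\<close> is already that of
    \<open>hermite_spline l m\<close>.\<close>
  moreover have "(1 - x) ^ Suc (Suc m) * negbinom_sum (Suc m) k x
      = (1 - x) ^ Suc m * (negbinom_sum m k x - ?B)"
    by (simp only: negbinom_sum_Suc_left[symmetric]) simp
  moreover have "x ^ l / fact l * ((1 - x) ^ Suc m * (negbinom_sum m k x - ?B))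
      + ?A * (x ^ Suc l / fact (Suc l))
      = - (fact (Suc m + k) * (2 * real (Suc m) + 1)
         / (fact (Suc l) * fact (Suc m) * fact k)) * (x * (1 - x)) ^ Suc m
     + x ^ l / fact l * ((1 - x) ^ Suc m * negbinom_sum m k x)"
  proof -
    have fact_Suc_k: "fact (Suc m + k + 1) = (real m + real k + 2) * fact (Suc m + k)"
      by (simp add: algebra_simps)
    have powers: "(x * (1 - x)) ^ Suc m = x ^ l * x ^ Suc k * (1 - x) ^ Suc m"
      by (simp add: m power_mult_distrib power_add)
    \<comment> \<open>Over the common denominator the weights are l + 1 and m + k + 2; as m = l + k,
      they add up to 2(m + 1) + 1.\<close>
    have bracket: "F * (2 * real (Suc m) + 1) / (a * (1 + real l) * g)
        = F / (a * g) + (real m + real k + 2) * F / (g * (a * (1 + real l)))"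
      if "a \<noteq> 0" "g \<noteq> 0" for F a g :: real
      using that by (simp add: m divide_simps) (simp add: algebra_simps)
    have regroup: "u / a * (Q * (S - F / g * (x * z))) + - (e * F / g) * z * Q * (x * u / b)
        = - (F / (a * g) + e * F / (g * b)) * (u * (x * z) * Q) + u / a * (Q * S)"
      for u a Q S F g z e b :: real
      by (simp add: algebra_simps add_divide_distrib diff_divide_distrib)
    have fact_Suc_l: "(fact (Suc l) :: real) = fact l * (1 + real l)"
      by (simp add: algebra_simps)
    show ?thesis
      unfolding fact_Suc_k powers fact_Suc_l power_Suc[of x] regroup
      using bracket[of "fact l" "fact (Suc m) * fact k" "fact (Suc m + k)"]
      by (simp only: mult.assoc) simp
  qed
  moreover have "2 * Suc m - Suc l = Suc m + k" "m - l = k"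
    by (simp_all add: m)
  ultimately show ?thesis
    by (simp only: hermite_spline_alt[of l m])
qed

theorem theorem2p5:
  fixes \<xi> :: real and m :: nat
  assumes "\<xi> \<in> {0..1}"
  shows "(hermite_spline 0 m has_real_derivative
            (-1) ^ (m + 1) / 2 ^ (2 * m) * (fact (2 * m + 1) / (fact m)\<^sup>2)
              * poly (J_poly (int m - 1) (2 * int m)) (2 * \<xi> - 1))
           (at \<xi> within {0..1}) \<and>
         (m > 1 \<longrightarrow> (\<forall>l\<in>{1..m}.
           (hermite_spline l m has_real_derivative
              (-1) ^ (m + 1) / 2 ^ (2 * m)
                * (fact (2 * m - l) * (2 * real m + 1) / (fact l * fact m * fact (m - l)))
                * poly (J_poly (int m - 1) (2 * int m)) (2 * \<xi> - 1)
              + hermite_spline (l - 1) (m - 1) \<xi>)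
             (at \<xi> within {0..1})))"
proof -
  let ?J = "poly (J_poly (int m - 1) (2 * int m)) (2 * \<xi> - 1)"
  have "?J = (- 4 * (\<xi> * (1 - \<xi>))) ^ m"
    unfolding poly_J_poly_twice by (simp add: power2_eq_square algebra_simps)
  also have "\<dots> = (- 1) ^ m * 2 ^ (2 * m) * (\<xi> * (1 - \<xi>)) ^ m"
    by (simp add: power_mult flip: power_mult_distrib)
  finally have "(-1) ^ (m + 1) / 2 ^ (2 * m) * ?J = - ((\<xi> * (1 - \<xi>)) ^ m)"
    by (simp flip: power_mult_distrib)
  then have J: "(-1) ^ (m + 1) / 2 ^ (2 * m) * c * ?J = - c * (\<xi> * (1 - \<xi>)) ^ m" for c
    by (metis mult.assoc mult.commute mult_minus_left mult_minus_right)
  have "(hermite_spline l m has_real_derivative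
      - (fact (2 * m - l) * (2 * real m + 1) / (fact l * fact m * fact (m - l)))
        * (\<xi> * (1 - \<xi>)) ^ m + hermite_spline (l - 1) (m - 1) \<xi>) (at \<xi>)"
    if "l \<in> {1..m}" for l
  proof -
    obtain l' m' where "l = Suc l'" "m = Suc m'"
      using \<open>l \<in> {1..m}\<close> by (cases l; cases m) auto
    then show ?thesis
      using hermite_spline_Suc_derivative[of l' m' \<xi>] that by simp
  qed
  \<comment> \<open>Both formulas are two-sided derivatives at any real point, so they restrict to
    the interval, end points included.\<close>
  then show ?thesis
    unfolding J using hermite_spline_0_derivative has_field_derivative_at_within by blast
qed

end
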